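(* For all $g_1,g_2,g_3\in\tilde{\mathrm{CH}}_2$, one has $W_1(g_1,g_2,g_3)=S_{-1}\big(W_0(g_1,g_2,g_3)\big)$.
   Context: Let $\mathrm{CH}_2$ be the commutative ring which is a free $\mathbb{Z}$-module with basis $\{h_i : i\ge 0\}$ and multiplication $h_ih_j=\sum_{k=0}^{\min(i,j)}h_{i+j-2k}$. Let $\tilde{\mathrm{CH}}_2$ be the free $\mathbb{Z}$-module with basis $\{\tilde h_i : i\in\mathbb{Z}\}$, with left $\mathrm{CH}_2$-action $h_i\tilde h_j=\sum_{k=0}^{i}\tilde h_{j-i+2k}$ ($i\ge0$), extended bilinearly. Let $L:\tilde{\mathrm{CH}}_2\to \mathrm{CH}_2$ be the $\mathbb{Z}$-linear map with $L(\tilde h_{-1})=0$, $L(\tilde h_i)=h_i$ for $i\ge 0$, $L(\tilde h_i)=-h_{-i-2}$ for $i\le -2$. The (associative, non-commutative) product on $\tilde{\mathrm{CH}}_2$ is $g_1g_2:=L(g_1)\,g_2$. For $i\in\mathbb{Z}$, $S_i$ is the $\mathbb{Z}$-linear map with $S_i(\tilde h_j)=\tilde h_{j+i}$. Define $W_0(g_1,g_2,g_3)=g_2\big(g_1g_3-S_{-1}(g_1)S_{-1}(g_3)\big)$ and $W_1(g_1,g_2,g_3)=S_{-1}(g_1)g_2g_3+g_1g_2S_{-1}(g_3)-S_{-1}(g_1)\tilde h_1g_2S_{-1}(g_3)$. *)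

theory Defs
  imports "HOL-Library.Poly_Mapping"
begin

text \<open>
  The free \<open>\<int>\<close>-module on a set is modelled by finitely supported integer-valued functions, and
  \<^const>\<open>frag_extend\<close> is \<open>\<int>\<close>-linear extension from the basis. Pitfall: the class operations
  \<open>*\<close> and \<open>1\<close> of these types are the convolution product and its unit, not the ring
  structures below, so those get their own names.
\<close>

type_synonym ch2 = "nat \<Rightarrow>\<^sub>0 int"
type_synonym ch2t = "int \<Rightarrow>\<^sub>0 int"

abbreviation h :: "nat \<Rightarrow> ch2" where "h \<equiv> frag_of"
abbreviation ht :: "int \<Rightarrow> ch2t" where "ht \<equiv> frag_of"

definition ch2_mult :: "ch2 \<Rightarrow> ch2 \<Rightarrow> ch2" (infixl "\<odot>" 70) where
  "a \<odot> b = frag_extend (\<lambda>i. frag_extend (\<lambda>j. \<Sum>k=0..min i j. h (i + j - 2 * k)) b) a"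

definition ch2_act :: "ch2 \<Rightarrow> ch2t \<Rightarrow> ch2t" (infixr "\<cdot>" 75) where
  "a \<cdot> g = frag_extend (\<lambda>i. frag_extend (\<lambda>j. \<Sum>k=0..i. ht (j - int i + 2 * int k)) g) a"

definition L :: "ch2t \<Rightarrow> ch2" where
  "L = frag_extend (\<lambda>i. if i = -1 then 0 else if i \<ge> 0 then h (nat i) else - h (nat (- i - 2)))"

definition ch2t_mult :: "ch2t \<Rightarrow> ch2t \<Rightarrow> ch2t" (infixl "\<star>" 70) where
  "g1 \<star> g2 = L g1 \<cdot> g2"

definition S :: "int \<Rightarrow> ch2t \<Rightarrow> ch2t" where
  "S i = frag_extend (\<lambda>j. ht (j + i))"

definition W0 :: "ch2t \<Rightarrow> ch2t \<Rightarrow> ch2t \<Rightarrow> ch2t" where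
  "W0 g1 g2 g3 = g2 \<star> (g1 \<star> g3 - S (-1) g1 \<star> S (-1) g3)"

definition W1 :: "ch2t \<Rightarrow> ch2t \<Rightarrow> ch2t \<Rightarrow> ch2t" where
  "W1 g1 g2 g3 = S (-1) g1 \<star> g2 \<star> g3 + g1 \<star> g2 \<star> S (-1) g3
     - S (-1) g1 \<star> ht 1 \<star> g2 \<star> S (-1) g3"

text \<open>
  The structures above are what their names suggest: \<open>\<odot>\<close> is a commutative ring
  multiplication with unit \<open>h 0\<close>, \<open>\<cdot>\<close> is a module action, and \<open>\<star>\<close> is
  associative, so the bracketing in \<^const>\<open>W1\<close> is immaterial. The key point is that
  \<open>h i\<close> acts as convolution with a Laurent polynomial.
\<close>

lemma frag_linear_ext:
  fixes F G :: "('a \<Rightarrow>\<^sub>0 int) \<Rightarrow> ('b \<Rightarrow>\<^sub>0 int)"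
  assumes "\<And>x y. F (x - y) = F x - F y" "\<And>x y. G (x - y) = G x - G y"
    and "\<And>i. F (frag_of i) = G (frag_of i)"
  shows "F x = G x"
proof -
  have z: "F 0 = 0" "G 0 = 0"
    using assms(1)[of 0 0] assms(2)[of 0 0] by simp_all
  have "Poly_Mapping.keys x \<subseteq> UNIV" by simp
  then show ?thesis
    by (induction x rule: frag_induction) (simp_all add: z assms)
qed

lemma ch2_act_h_ht: "h i \<cdot> ht j = (\<Sum>k=0..i. ht (j - int i + 2 * int k))"
  by (simp add: ch2_act_def)

lemma ch2_mult_h_h: "h i \<odot> h j = (\<Sum>k=0..min i j. h (i + j - 2 * k))"
  by (simp add: ch2_mult_def)

lemma frag_extend_diff_fun: "frag_extend (\<lambda>i. f i - g i) x = frag_extend f x - frag_extend g x"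
  by (rule frag_linear_ext) (simp_all add: frag_extend_diff)

lemma ch2_mult_diff_left: "(a - b) \<odot> c = a \<odot> c - b \<odot> c"
  by (simp add: ch2_mult_def frag_extend_diff)

lemma ch2_mult_diff_right: "a \<odot> (b - c) = a \<odot> b - a \<odot> c"
  by (simp add: ch2_mult_def frag_extend_diff frag_extend_diff_fun)

lemma ch2_act_diff_left: "(a - b) \<cdot> g = a \<cdot> g - b \<cdot> g"
  by (simp add: ch2_act_def frag_extend_diff)

lemma ch2_act_diff_right: "a \<cdot> (f - g) = a \<cdot> f - a \<cdot> g"
  by (simp add: ch2_act_def frag_extend_diff frag_extend_diff_fun)

lemma L_diff: "L (f - g) = L f - L g"
  by (simp add: L_def frag_extend_diff)

lemma S_diff: "S i (f - g) = S i f - S i g"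
  by (simp add: S_def frag_extend_diff)

lemma ch2_mult_commute: "a \<odot> b = b \<odot> a"
proof (rule frag_linear_ext[where x = a])
  fix i
  show "h i \<odot> b = b \<odot> h i"
    by (rule frag_linear_ext[where x = b])
      (simp_all add: ch2_mult_diff_left ch2_mult_diff_right ch2_mult_h_h min.commute add.commute)
qed (simp_all add: ch2_mult_diff_left ch2_mult_diff_right)

lemma ch2_mult_h0: "h 0 \<odot> a = a"
  by (rule frag_linear_ext[where x = a])
    (simp_all add: ch2_mult_diff_right ch2_mult_h_h del: single_one)

lemma ch2_act_h0: "h 0 \<cdot> g = g"
  by (rule frag_linear_ext[where x = g])
    (simp_all add: ch2_act_diff_right ch2_act_h_ht del: single_one)

definition laurent :: "ch2 \<Rightarrow> ch2t" where "laurent a = a \<cdot> ht 0"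

lemma laurent_h: "laurent (h i) = (\<Sum>k=0..i. ht (2 * int k - int i))"
  unfolding laurent_def ch2_act_h_ht by (simp add: algebra_simps)

lemma laurent_h_mult: "laurent (h i) * ht m = (\<Sum>k=0..i. ht (m - int i + 2 * int k))"
  unfolding laurent_h sum_distrib_right mult_single by (simp add: algebra_simps)

lemma ch2_act_laurent: "a \<cdot> g = laurent a * g"
proof (rule frag_linear_ext[where x = a])
  fix i
  show "h i \<cdot> g = laurent (h i) * g"
    by (rule frag_linear_ext[where x = g])
      (simp_all add: laurent_h_mult ch2_act_diff_right ch2_act_h_ht right_diff_distrib)
qed (simp_all add: laurent_def ch2_act_diff_left left_diff_distrib)

lemma laurent_diff: "laurent (a - b) = laurent a - laurent b"
  by (simp add: laurent_def ch2_act_diff_left)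

lemma laurent_sum: "laurent (\<Sum>k=0..(n::nat). f k) = (\<Sum>k=0..n. laurent (f k))"
  unfolding laurent_def ch2_act_def by (subst frag_extend_sum) simp_all

lemma laurent_telescope: "(ht 1 - ht (-1)) * laurent (h i) = ht (int i + 1) - ht (- int i - 1)"
proof -
  have "(ht 1 - ht (-1)) * laurent (h i)
      = (\<Sum>k=0..i. ht (- int i + 2 * int (Suc k) - 1) - ht (- int i + 2 * int k - 1))"
    by (simp add: laurent_h sum_distrib_left left_diff_distrib mult_single
        algebra_simps)
  also have "\<dots> = ht (int i + 1) - ht (- int i - 1)"
    by (subst sum_Suc_diff) (simp_all add: algebra_simps)
  finally show ?thesis .
qed

lemma laurent_mult: "laurent (a \<odot> b) = laurent a * laurent b"
proof -
  have le: "laurent (h i \<odot> h j) = laurent (h i) * laurent (h j)" if "i \<le> j" for i j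
  proof -
    have nz: "ht 1 - ht (-1) \<noteq> 0"
      by (simp add: frag_of_eq)
    have rev: "(\<Sum>k=0..i. ht (int (i + j - 2 * k) + 1)) = (\<Sum>k=0..i. ht (2 * int k - int i + int j + 1))"
      by (subst sum.atLeastAtMost_rev) (rule sum.cong, use that in \<open>auto simp: of_nat_diff algebra_simps\<close>)
    have "(ht 1 - ht (-1)) * laurent (h i \<odot> h j)
        = (\<Sum>k=0..i. ht (int (i + j - 2 * k) + 1) - ht (- int (i + j - 2 * k) - 1))"
      using that by (simp add: ch2_mult_h_h laurent_sum sum_distrib_left laurent_telescope)
    also have "\<dots> = (\<Sum>k=0..i. ht (2 * int k - int i + int j + 1))
        - (\<Sum>k=0..i. ht (2 * int k - int i - int j - 1))"
      unfolding sum_subtractf rev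
      by (intro arg_cong2[where f = minus] refl sum.cong)
        (use that in \<open>auto simp: of_nat_diff algebra_simps\<close>)
    also have "\<dots> = laurent (h i) * (ht (int j + 1) - ht (- int j - 1))"
      unfolding right_diff_distrib laurent_h_mult by (simp add: algebra_simps)
    also have "\<dots> = (ht 1 - ht (-1)) * (laurent (h i) * laurent (h j))"
      by (simp add: laurent_telescope[symmetric] mult_ac)
    finally show ?thesis
      using nz by simp
  qed
  have hh: "laurent (h i \<odot> h j) = laurent (h i) * laurent (h j)" for i j
    using le[of i j] le[of j i] by (cases "i \<le> j") (simp_all add: ch2_mult_commute mult.commute)
  show ?thesis
  proof (rule frag_linear_ext[where x = a])
    fix i
    show "laurent (h i \<odot> b) = laurent (h i) * laurent b"
      by (rule frag_linear_ext[where x = b])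
        (simp_all add: hh laurent_diff ch2_mult_diff_right right_diff_distrib)
  qed (simp_all add: laurent_diff ch2_mult_diff_left left_diff_distrib)
qed

lemma ch2_act_act: "(a \<odot> b) \<cdot> g = a \<cdot> b \<cdot> g"
  by (simp add: ch2_act_laurent laurent_mult mult.assoc)

lemma laurent_inject:
  assumes "laurent a = laurent b"
  shows "a = b"
proof -
  define R where "R = frag_extend (\<lambda>j::int. if j \<ge> 1 then h (nat (j - 1)) else 0)"
  have "R ((ht 1 - ht (-1)) * laurent c) = c" for c
    by (rule frag_linear_ext[where x = c])
      (simp_all add: R_def frag_extend_diff laurent_diff right_diff_distrib laurent_telescope)
  then show ?thesis
    using assms by metis
qed

lemma ch2_mult_assoc: "(a \<odot> b) \<odot> c = a \<odot> (b \<odot> c)"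
  by (rule laurent_inject) (simp add: laurent_mult mult.assoc)

lemma laurent_L_telescope:
  "(ht 1 - ht (-1)) * laurent (L (ht j)) = ht (j + 1) - ht (- j - 1)"
proof -
  consider "j = -1" | "j \<ge> 0" | "j \<le> -2" by linarith
  then show ?thesis
  proof cases
    case 1
    then show ?thesis using laurent_diff[of 0 0] by (simp add: L_def)
  next
    case 2
    then show ?thesis by (simp add: L_def laurent_telescope)
  next
    case 3
    have "laurent (- h (nat (- j - 2))) = - laurent (h (nat (- j - 2)))"
      using laurent_diff[of 0 "h (nat (- j - 2))"] laurent_diff[of 0 0] by simp
    with 3 have "(ht 1 - ht (-1)) * laurent (L (ht j))
        = - ((ht 1 - ht (-1)) * laurent (h (nat (- j - 2))))"
      by (simp add: L_def)
    also have "\<dots> = ht (j + 1) - ht (- j - 1)"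
      unfolding laurent_telescope minus_diff_eq
      by (intro arg_cong2[where f = minus] arg_cong[where f = frag_of]) (use 3 in auto)
    finally show ?thesis .
  qed
qed

lemma L_act: "L (a \<cdot> g) = a \<odot> L g"
proof (rule frag_linear_ext[where x = a])
  fix i
  show "L (h i \<cdot> g) = h i \<odot> L g"
  proof (rule frag_linear_ext[where x = g])
    fix j
    have nz: "ht 1 - ht (-1) \<noteq> 0"
      by (simp add: frag_of_eq)
    have Lsum: "L (\<Sum>k=0..i. f k) = (\<Sum>k=0..i. L (f k))" for f
      unfolding L_def by (subst frag_extend_sum) simp_all
    have rev: "(\<Sum>k=0..i. ht (- (j - int i + 2 * int k) - 1))
        = (\<Sum>k=0..i. ht (2 * int k - int i - j - 1))"
      by (subst sum.atLeastAtMost_rev) (rule sum.cong, auto simp: of_nat_diff algebra_simps)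
    have "(ht 1 - ht (-1)) * laurent (L (h i \<cdot> ht j))
        = (\<Sum>k=0..i. ht (j - int i + 2 * int k + 1))
          - (\<Sum>k=0..i. ht (- (j - int i + 2 * int k) - 1))"
      unfolding ch2_act_h_ht Lsum laurent_sum sum_distrib_left laurent_L_telescope sum_subtractf ..
    also have "\<dots> = laurent (h i) * (ht (j + 1) - ht (- j - 1))"
      unfolding rev right_diff_distrib laurent_h_mult by (simp add: algebra_simps)
    also have "\<dots> = (ht 1 - ht (-1)) * laurent (h i \<odot> L (ht j))"
      unfolding laurent_L_telescope[symmetric] laurent_mult by (simp only: mult_ac)
    finally show "L (h i \<cdot> ht j) = h i \<odot> L (ht j)"
      using nz by (intro laurent_inject) simp
  qed (simp_all add: L_diff ch2_act_diff_right ch2_mult_diff_right)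
qed (simp_all add: L_diff ch2_act_diff_left ch2_mult_diff_left)

lemma ch2t_mult_assoc: "(f \<star> g) \<star> k = f \<star> (g \<star> k)"
  by (simp add: ch2t_mult_def L_act ch2_act_act)

end

theory Submission
  imports Defs
begin

text \<open>
  Identify \<open>ht j\<close> with the Laurent monomial \<open>x\<^sup>j\<close>, so that \<open>*\<close> is the
  product of Laurent polynomials. Then \<open>S j\<close> is multiplication by \<open>x\<^sup>j\<close> and
  \<open>f \<star> g\<close> is \<open>p f * g\<close>, where \<open>p = laurent \<circ> L\<close> satisfies
  \<open>p (f \<star> g) = p f * p g\<close>. As \<open>p (ht 1) = x + x\<^sup>-\<^sup>1\<close>, the theorem becomes an
  identity in a commutative ring, in which \<open>p g1\<close> and \<open>p (S (-1) g1)\<close> may be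
  treated as independent variables.
\<close>

lemma S_laurent: "S i g = ht i * g"
  by (rule frag_linear_ext[where x = g])
    (simp_all add: S_diff right_diff_distrib, simp add: S_def mult_single add.commute)

lemma ch2t_mult_laurent: "f \<star> g = laurent (L f) * g"
  by (simp add: ch2t_mult_def ch2_act_laurent)

text \<open>\<open>L\<close> commutes with the action of \<open>ch2\<close>, and
  \<open>laurent\<close> turns \<open>\<odot>\<close> into \<open>*\<close>.\<close>

lemma laurent_L_ch2t_mult: "laurent (L (f \<star> g)) = laurent (L f) * laurent (L g)"
  by (simp add: ch2t_mult_def L_act laurent_mult)

lemma laurent_L_ht_1: "laurent (L (ht 1)) = ht 1 + ht (-1)"
  by (simp add: L_def laurent_h)

theorem theorem1:
  fixes g1 g2 g3 :: ch2t
  shows "W1 g1 g2 g3 = S (-1) (W0 g1 g2 g3)"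
proof -
  define x y P Q G where "x = ht 1" and "y = ht (-1)" and "P = laurent (L g1)"
    and "Q = laurent (L (S (-1) g1))" and "G = laurent (L g2)"
  have xy: "x * y = 1"
    by (simp add: x_def y_def mult_single)
  have "W1 g1 g2 g3 = Q * G * g3 + P * G * (y * g3) - Q * (x + y) * G * (y * g3)"
    \<comment> \<open>Fixing the right factor keeps the inner \<open>\<star>\<close> products intact
      for \<open>laurent_L_ch2t_mult\<close>, and \<open>S (-1) g1\<close> folded inside
      \<open>Q\<close>.\<close>
    unfolding W1_def ch2t_mult_laurent[of _ g3] ch2t_mult_laurent[of _ "ht (-1) * g3"]
      laurent_L_ch2t_mult laurent_L_ht_1 S_laurent[of _ g3] x_def y_def P_def Q_def G_def ..
  \<comment> \<open>Splitting off the multiple of \<open>1 - x * y\<close> leaves a polynomial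
    identity, valid without the relation \<open>x * y = 1\<close>.\<close>
  also have "\<dots> = y * (G * (P * g3 - Q * (y * g3))) + (1 - x * y) * (Q * G * g3)"
    by (simp add: algebra_simps)
  also have "\<dots> = y * (G * (P * g3 - Q * (y * g3)))"
    by (simp add: xy)
  also have "\<dots> = S (-1) (W0 g1 g2 g3)"
    unfolding W0_def ch2t_mult_laurent S_laurent[of _ g3] y_def P_def Q_def G_def
    by (rule S_laurent[symmetric])
  finally show ?thesis .
qed

end
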